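(* If $G$ is a simple, 3-connected embedded graph, then $\mathrm{Ambo}(G)$, $\mathrm{Truncation}(G)$, $\mathrm{Capra}(G)$, $\mathrm{Chamfer}(G)$, $\mathrm{Snub}(G)$, $\mathrm{Gyro}(G)$ and $\mathrm{Leapfrog}(G)$ are 3-connected.
   Context: Graphs are finite and may have loops and multiple edges; a graph is simple if it has neither. An embedded graph is a connected graph with at least one edge together with a rotation system: each edge has two oriented edges $e,e^{-1}$, one for each of its end vertices (the associated vertex, denoted $\mathrm{tail}(e)$), and $\sigma$ is a permutation of the oriented edges inducing a cyclic ordering of the oriented edges at each vertex. Put $\varphi(e)=\sigma(e^{-1})$. The faces are the orbits of $\varphi$; $f(e)$ denotes the face containing $e$. A graph is 3-connected if it has at least four vertices and no vertex-cut of fewer than three vertices. Underlying graphs of the standard operations applied to $G$ (3-connectivity depends only on the underlying graph; "for each $e$" means for each oriented edge of $G$): - $\mathrm{Ambo}(G)$ (medial graph): the vertices are the edges of $G$; for each $e$ there is an edge joining the edges of $G$ underlying $e$ and $\sigma(e)$. - $\mathrm{Truncation}(G)$: the vertices are the oriented edges; for each $e$ an edge joining $e$ and $\sigma(e)$; for each pair $\{e,e^{-1}\}$ one edge joining $e$ and $e^{-1}$. - $\mathrm{Leapfrog}(G)$ (truncation of the dual): the vertices are the oriented edges; for each $e$ an edge joining $e$ and $\varphi(e)$; for each pair $\{e,e^{-1}\}$ one edge joining $e$ and $e^{-1}$. - $\mathrm{Chamfer}(G)$: the vertices are $V_G$ together with one vertex $c_e$ for each $e$; for each $e$ an edge joining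 $\mathrm{tail}(e)$ and $c_e$, and an edge joining $c_e$ and $c_{\varphi(e)}$. - $\mathrm{Snub}(G)$: the vertices are the oriented edges; for each $e$ an edge joining $e$ and $\varphi(e)$, and an edge joining $e$ and $\sigma(e)$; for each pair $\{e,e^{-1}\}$ one edge joining $e$ and $e^{-1}$. - $\mathrm{Gyro}(G)$: the vertices are $V_G\cup F_G$ together with one vertex $p_e$ for each $e$; for each $e$ an edge joining $\mathrm{tail}(e)$ and $p_e$, and an edge joining $f(e)$ and $p_e$; for each pair $\{e,e^{-1}\}$ one edge joining $p_e$ and $p_{e^{-1}}$. - $\mathrm{Capra}(G)$: the vertices are $V_G$ together with vertices $p_e,q_e$ for each $e$; for each $e$ edges joining $\mathrm{tail}(e)$ and $p_e$, $p_e$ and $q_e$, and $q_e$ and $q_{\varphi(e)}$; for each pair $\{e,e^{-1}\}$ one edge joining $p_e$ and $p_{e^{-1}}$. *)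

theory Defs
  imports "Graph_Theory.Graph_Theory" "HOL-Combinatorics.Orbits"
begin

text \<open>
  The arcs of a \<^locale>\<open>bidirected_digraph\<close> are the oriented edges of a multigraph, loops included
  (\<open>arev\<close> is fixed-point free on arcs); \<open>tail\<close> is the associated vertex and \<open>arev\<close> is $e \mapsto e^{-1}$.
\<close>

locale embedded_graph = fin_digraph G + bidirected_digraph G arev
  for G :: "('v, 'd) pre_digraph" and arev :: "'d \<Rightarrow> 'd" +
  fixes rot :: "'d \<Rightarrow> 'd"
  assumes connected_graph: "connected G"
    and has_edge: "arcs G \<noteq> {}"
    and rot_permutes: "rot permutes arcs G"
    and rot_cyclic: "v \<in> verts G \<Longrightarrow> cyclic_on rot (out_arcs G v)"

definition face_succ :: "('d \<Rightarrow> 'd) \<Rightarrow> ('d \<Rightarrow> 'd) \<Rightarrow> 'd \<Rightarrow> 'd" where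
  "face_succ arev rot e = rot (arev e)"

definition face_of :: "('d \<Rightarrow> 'd) \<Rightarrow> ('d \<Rightarrow> 'd) \<Rightarrow> 'd \<Rightarrow> 'd set" where
  "face_of arev rot e = orbit (face_succ arev rot) e"

definition faces :: "('v, 'd) pre_digraph \<Rightarrow> ('d \<Rightarrow> 'd) \<Rightarrow> ('d \<Rightarrow> 'd) \<Rightarrow> 'd set set" where
  "faces G arev rot = face_of arev rot ` arcs G"

definition edge_of :: "('d \<Rightarrow> 'd) \<Rightarrow> 'd \<Rightarrow> 'd set" where
  "edge_of arev e = {e, arev e}"

definition edges :: "('v, 'd) pre_digraph \<Rightarrow> ('d \<Rightarrow> 'd) \<Rightarrow> 'd set set" where
  "edges G arev = edge_of arev ` arcs G"

text \<open>
  The empty set is a vertex-cut of a disconnected graph. Removing all vertices is excluded, since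
  \<^const>\<open>connected\<close> is false for the graph without vertices. It ignores the direction of arcs.
\<close>

definition vertex_cut :: "('v, 'e) pre_digraph \<Rightarrow> 'v set \<Rightarrow> bool" where
  "vertex_cut G S \<longleftrightarrow> S \<subset> verts G \<and> \<not> connected (G \<restriction> (verts G - S))"

definition three_connected :: "('v, 'e) pre_digraph \<Rightarrow> bool" where
  "three_connected G \<longleftrightarrow> 4 \<le> card (verts G) \<and> \<not> (\<exists>S. vertex_cut G S \<and> card S < 3)"

text \<open>
  The multigraph with vertex set \<open>V\<close> and labelled edges \<open>E\<close>, where \<open>(l, {u, v})\<close> is an edge joining
  \<open>u\<close> and \<open>v\<close> and distinct labels keep parallel edges apart. Each edge becomes two opposite arcs,
  except that a loop becomes one arc, which does not affect connectivity.
\<close>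

definition multigraph :: "'v set \<Rightarrow> ('l \<times> 'v set) set \<Rightarrow> ('v, 'l \<times> 'v \<times> 'v) pre_digraph" where
  "multigraph V E =
    \<lparr>verts = V, arcs = {(l, u, v). (l, {u, v}) \<in> E},
     tail = (\<lambda>(l, u, v). u), head = (\<lambda>(l, u, v). v)\<rparr>"

text \<open>
  \<open>Side k e\<close> labels the edge of the \<open>k\<close>th kind belonging to the oriented edge \<open>e\<close>, and \<open>Link p\<close>
  labels the one edge belonging to the pair \<open>p\<close> consisting of $e$ and $e^{-1}$.
\<close>

datatype 'd label = Side nat 'd | Link "'d set"

datatype ('v, 'd) op_vertex = Base 'v | Face "'d set" | Pt 'd | Qt 'd

definition Ambo ::
  "('v, 'd) pre_digraph \<Rightarrow> ('d \<Rightarrow> 'd) \<Rightarrow> ('d \<Rightarrow> 'd) \<Rightarrow> ('d set, 'd label \<times> 'd set \<times> 'd set) pre_digraph" where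
  "Ambo G arev rot = multigraph (edges G arev)
    {(Side 0 e, {edge_of arev e, edge_of arev (rot e)}) | e. e \<in> arcs G}"

definition Truncation ::
  "('v, 'd) pre_digraph \<Rightarrow> ('d \<Rightarrow> 'd) \<Rightarrow> ('d \<Rightarrow> 'd) \<Rightarrow> ('d, 'd label \<times> 'd \<times> 'd) pre_digraph" where
  "Truncation G arev rot = multigraph (arcs G)
    ({(Side 0 e, {e, rot e}) | e. e \<in> arcs G} \<union>
     {(Link p, p) | p. p \<in> edges G arev})"

definition Leapfrog ::
  "('v, 'd) pre_digraph \<Rightarrow> ('d \<Rightarrow> 'd) \<Rightarrow> ('d \<Rightarrow> 'd) \<Rightarrow> ('d, 'd label \<times> 'd \<times> 'd) pre_digraph" where
  "Leapfrog G arev rot = multigraph (arcs G)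
    ({(Side 0 e, {e, face_succ arev rot e}) | e. e \<in> arcs G} \<union>
     {(Link p, p) | p. p \<in> edges G arev})"

definition Chamfer ::
  "('v, 'd) pre_digraph \<Rightarrow> ('d \<Rightarrow> 'd) \<Rightarrow> ('d \<Rightarrow> 'd) \<Rightarrow>
    (('v, 'd) op_vertex, 'd label \<times> ('v, 'd) op_vertex \<times> ('v, 'd) op_vertex) pre_digraph" where
  "Chamfer G arev rot = multigraph (Base ` verts G \<union> Pt ` arcs G)
    ({(Side 0 e, {Base (tail G e), Pt e}) | e. e \<in> arcs G} \<union>
     {(Side 1 e, {Pt e, Pt (face_succ arev rot e)}) | e. e \<in> arcs G})"

definition Snub ::
  "('v, 'd) pre_digraph \<Rightarrow> ('d \<Rightarrow> 'd) \<Rightarrow> ('d \<Rightarrow> 'd) \<Rightarrow> ('d, 'd label \<times> 'd \<times> 'd) pre_digraph" where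
  "Snub G arev rot = multigraph (arcs G)
    ({(Side 0 e, {e, face_succ arev rot e}) | e. e \<in> arcs G} \<union>
     {(Side 1 e, {e, rot e}) | e. e \<in> arcs G} \<union>
     {(Link p, p) | p. p \<in> edges G arev})"

definition Gyro ::
  "('v, 'd) pre_digraph \<Rightarrow> ('d \<Rightarrow> 'd) \<Rightarrow> ('d \<Rightarrow> 'd) \<Rightarrow>
    (('v, 'd) op_vertex, 'd label \<times> ('v, 'd) op_vertex \<times> ('v, 'd) op_vertex) pre_digraph" where
  "Gyro G arev rot = multigraph (Base ` verts G \<union> Face ` faces G arev rot \<union> Pt ` arcs G)
    ({(Side 0 e, {Base (tail G e), Pt e}) | e. e \<in> arcs G} \<union>
     {(Side 1 e, {Face (face_of arev rot e), Pt e}) | e. e \<in> arcs G} \<union>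
     {(Link p, Pt ` p) | p. p \<in> edges G arev})"

definition Capra ::
  "('v, 'd) pre_digraph \<Rightarrow> ('d \<Rightarrow> 'd) \<Rightarrow> ('d \<Rightarrow> 'd) \<Rightarrow>
    (('v, 'd) op_vertex, 'd label \<times> ('v, 'd) op_vertex \<times> ('v, 'd) op_vertex) pre_digraph" where
  "Capra G arev rot = multigraph (Base ` verts G \<union> Pt ` arcs G \<union> Qt ` arcs G)
    ({(Side 0 e, {Base (tail G e), Pt e}) | e. e \<in> arcs G} \<union>
     {(Side 1 e, {Pt e, Qt e}) | e. e \<in> arcs G} \<union>
     {(Side 2 e, {Qt e, Qt (face_succ arev rot e)}) | e. e \<in> arcs G} \<union>
     {(Link p, Pt ` p) | p. p \<in> edges G arev})"

end

theory Submission
  imports Defs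
begin

text \<open>
  Let $H$ be one of the seven graphs, and delete two of its vertices $a$ and $b$ (deleting fewer
  is no harder, as $H$ has at least four vertices). Attach to every vertex $v$ of $G$ a connected
  region $K(v)$ of $H$ such that the regions of adjacent vertices meet or are joined by an edge, and
  choose a set $X$ of at most two vertices of $G$ that absorbs the damage: for $v \<notin> X$ what
  survives of $K(v)$ is still connected, for each edge of $G$ that avoids $X$ the regions of its
  ends are still joined, and every surviving vertex of $H$ is joined to the region of some
  $v \<notin> X$. As $G$ is 3-connected, $G - X$ is connected, and hence so is the rest of $H$; this is the
  lemma \<open>joined_by_regions\<close>.

  The regions of Chamfer, Gyro and Capra are trees spread out from the vertices of $G$, and $X$
  consists of the vertices of $G$ whose regions contain $a$ or $b$. A survivor in a damaged region
  mostly escapes along its face: three consecutive oriented edges of a face have distinct tails, so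
  one of these is not in $X$ (\<open>ex_consecutive_tail_notin\<close>). This holds because $G$ is simple and has
  no vertex of degree 1, although a face may well pass through the same vertex several times.

  The regions of Truncation, Ambo and Leapfrog are cycles around the vertices of $G$, and a cycle
  that loses one vertex is still connected (\<open>cyclic_minus_point_joined\<close>). In Truncation and Ambo a
  survivor at a damaged cycle moves along what is left of the cycle to an edge of $G$ leading
  out of $X$, which exists since degrees are at least 3. In Leapfrog an oriented edge lies on the
  cycles around both of its ends, so that only a vertex incident with both $a$ and $b$ has to
  be put into $X$. Snub contains Truncation as a spanning subgraph.
\<close>

section \<open>Connectivity of multigraphs with deleted vertices\<close>

text \<open>
  Here \<open>W\<close> is the set of surviving vertices. Outside \<open>W\<close> the relation is equality, which makes it an
  equivalence without side conditions.
\<close>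

definition joined :: "('l \<times> 'h set) set \<Rightarrow> 'h set \<Rightarrow> 'h \<Rightarrow> 'h \<Rightarrow> bool" where
  "joined E W x y \<longleftrightarrow> (x, y) \<in> {(x, y). x \<in> W \<and> y \<in> W \<and> (\<exists>l. (l, {x, y}) \<in> E)}\<^sup>*"

lemma joined_refl [simp]: "joined E W x x"
  by (simp add: joined_def)

lemma joined_edge: "(l, {x, y}) \<in> E \<Longrightarrow> x \<in> W \<Longrightarrow> y \<in> W \<Longrightarrow> joined E W x y"
  unfolding joined_def by (rule r_into_rtrancl) auto

lemma joined_trans: "joined E W x y \<Longrightarrow> joined E W y z \<Longrightarrow> joined E W x z"
  unfolding joined_def by (rule rtrancl_trans)

lemma joined_sym: "joined E W x y \<Longrightarrow> joined E W y x"
  unfolding joined_def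
  by (rule symD[OF sym_rtrancl]) (auto intro!: symI simp: insert_commute)

lemma connected_induced_multigraph_iff:
  "connected (multigraph V E \<restriction> W) \<longleftrightarrow> W \<noteq> {} \<and> (\<forall>x\<in>W. \<forall>y\<in>W. joined E W x y)"
proof -
  let ?A = "(arcs_ends (multigraph V E \<restriction> W))\<^sup>s"
  have A: "?A = {(x, y). x \<in> W \<and> y \<in> W \<and> (\<exists>l. (l, {x, y}) \<in> E)}"
    unfolding symcl_def arcs_ends_conv
    by (auto simp: multigraph_def insert_commute image_iff)
  have "(x, y) \<in> rtrancl_on W ?A \<longleftrightarrow> joined E W x y" if "x \<in> W" "y \<in> W" for x y
  proof
    show "(x, y) \<in> rtrancl_on W ?A \<Longrightarrow> joined E W x y"
      unfolding joined_def A[symmetric] by (rule rtrancl_on_rtranclI)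
    assume "joined E W x y"
    then have "(x, y) \<in> ?A\<^sup>*" unfolding joined_def A .
    then show "(x, y) \<in> rtrancl_on W ?A"
      using that by (rule rtrancl_consistent_rtrancl_on) (simp add: A)
  qed
  then show ?thesis
    by (simp add: connected_conv)
qed

lemma three_connected_multigraphI:
  assumes fin: "finite V" and four: "4 \<le> card V"
    and pairs: "\<And>a b x y. a \<in> V \<Longrightarrow> b \<in> V \<Longrightarrow> a \<noteq> b \<Longrightarrow> x \<in> V - {a, b} \<Longrightarrow> y \<in> V - {a, b} \<Longrightarrow>
      joined E (V - {a, b}) x y"
  shows "three_connected (multigraph V E)"
proof -
  have "connected (multigraph V E \<restriction> (V - S))" if S: "S \<subset> V" "card S < 3" for S
    unfolding connected_induced_multigraph_iff
  proof (intro conjI ballI)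
    show "V - S \<noteq> {}" using S by auto
    fix x y assume x: "x \<in> V - S" and y: "y \<in> V - S"
    have "finite S" using S fin finite_subset by auto
    \<comment> \<open>Four vertices suffice to fill up the deleted set to a pair avoiding \<open>x\<close> and \<open>y\<close>.\<close>
    have "card (V - {x, y}) \<ge> 2"
      using four fin card_insert_le_m1[of 2 "{y}" x] diff_card_le_card_Diff[of "{x, y}" V] by auto
    moreover have "S \<subseteq> V - {x, y}" using S x y by auto
    ultimately obtain T where T: "S \<subseteq> T" "T \<subseteq> V - {x, y}" "card T = 2"
      using exists_subset_between[of S 2 "V - {x, y}"] S fin by auto
    then obtain a b where ab: "T = {a, b}" "a \<noteq> b" by (auto simp: card_2_iff)
    then have "joined E (V - {a, b}) x y"
      using T x y by (intro pairs) auto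
    then show "joined E (V - S) x y"
      unfolding joined_def by (rule rtrancl_mono[THEN subsetD, rotated]) (use T ab in auto)
  qed
  then show ?thesis
    using four unfolding three_connected_def vertex_cut_def
    by (auto simp: multigraph_def)
qed

lemma three_connected_multigraph_mono:
  assumes H: "three_connected (multigraph V E)"
    and sub: "\<And>l p. (l, p) \<in> E \<Longrightarrow> \<exists>l'. (l', p) \<in> E'"
  shows "three_connected (multigraph V E')"
proof -
  have "joined E W x y \<Longrightarrow> joined E' W x y" for W x y
    unfolding joined_def by (rule rtrancl_mono[THEN subsetD, rotated]) (use sub in blast)+
  then have "connected (multigraph V E \<restriction> W) \<Longrightarrow> connected (multigraph V E' \<restriction> W)" for W
    unfolding connected_induced_multigraph_iff by blast
  moreover have "verts (multigraph V E) = V" "verts (multigraph V E') = V"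
    by (simp_all add: multigraph_def)
  ultimately show ?thesis
    using H unfolding three_connected_def vertex_cut_def by auto
qed

text \<open>
  Only the steps that touch \<open>a\<close> may be missing, and \<open>a\<close> need not lie on the cycle. The map \<open>g\<close>
  places the cycle in the graph; for Ambo it sends an oriented edge to its edge.
\<close>

lemma cyclic_minus_point_joined:
  assumes cyc: "cyclic_on f A"
    and steps: "\<And>x. x \<in> A \<Longrightarrow> x \<noteq> a \<Longrightarrow> f x \<noteq> a \<Longrightarrow> joined E W (g x) (g (f x))"
    and x: "x \<in> A" "x \<noteq> a" and y: "y \<in> A" "y \<noteq> a"
  shows "joined E W (g x) (g y)"
proof (cases "a \<in> A")
  case True
  then have A: "A = orbit f a" using cyc by (simp add: orbit_cyclic_eq3)
  have "z \<noteq> a \<longrightarrow> joined E W (g (f a)) (g z)" if "z \<in> orbit f a" for z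
    using that
  proof induction
    case (step z)
    show ?case
      using step steps[of z] A by (cases "z = a") (auto intro: joined_trans)
  qed simp
  then show ?thesis using x y A by (auto intro: joined_trans joined_sym)
next
  case False
  have A: "A = orbit f x" using cyc x by (simp add: orbit_cyclic_eq3)
  have succ: "joined E W (g z) (g (f z))" if "z \<in> A" for z
    using that False cyclic_on_inI[OF cyc that] by (intro steps) auto
  have "joined E W (g x) (g z)" if "z \<in> orbit f x" for z
    using that
  proof induction
    case base
    then show ?case using succ x by blast
  next
    case (step z)
    then show ?case using succ A by (blast intro: joined_trans)
  qed
  then show ?thesis using y A by simp
qed

section \<open>Simple 3-connected embedded graphs\<close>

locale simple_three_connected_embedding =
  embedded_graph G arev rot + loopfree_digraph G + nomulti_digraph G
  for G :: "('v, 'd) pre_digraph" and arev rot :: "'d \<Rightarrow> 'd" +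
  assumes three_conn: "three_connected G"
begin

abbreviation \<phi> :: "'d \<Rightarrow> 'd" where
  "\<phi> \<equiv> face_succ arev rot"

lemma arc_eqI: "e \<in> arcs G \<Longrightarrow> d \<in> arcs G \<Longrightarrow> tail G e = tail G d \<Longrightarrow> head G e = head G d \<Longrightarrow> e = d"
  by (rule no_multi_arcs) (auto simp: arc_to_ends_def)

lemma rot_in_arcs [simp]: "e \<in> arcs G \<Longrightarrow> rot e \<in> arcs G"
  using permutes_in_image[OF rot_permutes] by simp

lemma tail_rot [simp]: "e \<in> arcs G \<Longrightarrow> tail G (rot e) = tail G e"
  using cyclic_on_inI[OF rot_cyclic[of "tail G e"], of e] by simp

lemma phi_in_arcs [simp]: "e \<in> arcs G \<Longrightarrow> \<phi> e \<in> arcs G"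
  by (simp add: face_succ_def)

lemma tail_phi [simp]: "e \<in> arcs G \<Longrightarrow> tail G (\<phi> e) = head G e"
  by (simp add: face_succ_def)

lemma phi_permutes: "\<phi> permutes arcs G"
proof -
  have "\<phi> = rot \<circ> arev" by (auto simp: face_succ_def)
  then show ?thesis
    using permutes_compose[OF arev_permutes_arcs rot_permutes] by simp
qed

lemma face_of_phi [simp]: "face_of arev rot (\<phi> e) = face_of arev rot e"
  unfolding face_of_def
  by (rule permutation_orbit_step) (metis permutation_permutes phi_permutes finite_arcs)

lemma phi_predE:
  assumes "e \<in> arcs G"
  obtains d where "d \<in> arcs G" "\<phi> d = e"
proof -
  have "e \<in> \<phi> ` arcs G" using assms by (simp add: permutes_image[OF phi_permutes])
  then show ?thesis using that by auto
qed

lemma connected_delete: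
  assumes "finite X" "card X \<le> 2"
  shows "connected (G \<restriction> (verts G - X))"
proof -
  let ?Y = "X \<inter> verts G"
  have "card ?Y \<le> card X" using assms by (intro card_mono) auto
  then have "card ?Y < 3" "?Y \<noteq> verts G"
    using assms three_conn by (auto simp: three_connected_def)
  then have "connected (G \<restriction> (verts G - ?Y))"
    using three_conn unfolding three_connected_def vertex_cut_def by blast
  moreover have "verts G - ?Y = verts G - X" by auto
  ultimately show ?thesis by simp
qed

text \<open>
  Apart from \<open>v\<close> and \<open>X\<close> there is a fourth vertex, and a walk in \<open>G - X\<close> from \<open>v\<close> to it has a first
  edge. All facts about degrees come from here.
\<close>

lemma ex_arc_avoiding:
  assumes X: "finite X" "card X \<le> 2" and v: "v \<in> verts G - X"
  obtains e where "e \<in> arcs G" "tail G e = v" "head G e \<notin> X"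
proof -
  let ?H = "G \<restriction> (verts G - X)"
  have "card (insert v X) \<le> 3" using X by (auto simp: card_insert_if)
  moreover have "card (verts G) \<ge> 4" using three_conn by (simp add: three_connected_def)
  ultimately have "\<not> verts G \<subseteq> insert v X" using card_mono[of "insert v X" "verts G"] X by auto
  then obtain w where w: "w \<in> verts G - X" "w \<noteq> v" by auto
  have "(v, w) \<in> rtrancl_on (verts G - X) ((arcs_ends ?H)\<^sup>s)"
    using connected_delete[OF X] v w by (auto simp: connected_conv)
  then obtain c where "(v, c) \<in> (arcs_ends ?H)\<^sup>s"
    using w(2) by (cases rule: converse_rtrancl_on_cases) auto
  then obtain e where e: "e \<in> arcs G" "tail G e \<notin> X" "head G e \<notin> X" "tail G e = v \<or> head G e = v"
    by (auto simp: symcl_def arcs_ends_conv)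
  show ?thesis
    using e that[of e] that[of "arev e"] by auto
qed

lemma ex_third_arc:
  assumes "v \<in> verts G"
  obtains e where "e \<in> arcs G" "tail G e = v" "e \<noteq> a" "e \<noteq> b"
proof -
  let ?X = "{head G a, head G b} - {v}"
  have "card ?X \<le> card {head G a, head G b}" by (intro card_mono) auto
  also have "\<dots> \<le> 2" by (simp add: card_insert_if)
  finally have "card ?X \<le> 2" .
  then obtain e where "e \<in> arcs G" "tail G e = v" "head G e \<notin> ?X"
    using assms ex_arc_avoiding[of ?X v] by auto
  moreover from this have "head G e \<noteq> v" using no_loops[of e] by auto
  ultimately show ?thesis using that[of e] by auto
qed

lemma ex_arc_avoiding_arc_and_vertex:
  assumes "v \<in> verts G"
  obtains e where "e \<in> arcs G" "tail G e = v" "e \<noteq> a" "head G e \<noteq> w"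
proof -
  let ?X = "{head G a, w} - {v}"
  have "card ?X \<le> card {head G a, w}" by (intro card_mono) auto
  also have "\<dots> \<le> 2" by (simp add: card_insert_if)
  finally have "card ?X \<le> 2" .
  then obtain e where "e \<in> arcs G" "tail G e = v" "head G e \<notin> ?X"
    using assms ex_arc_avoiding[of ?X v] by auto
  moreover from this have "head G e \<noteq> v" using no_loops[of e] by auto
  ultimately show ?thesis using that[of e] by auto
qed

lemma rot_neq:
  assumes "e \<in> arcs G"
  shows "rot e \<noteq> e"
proof
  assume "rot e = e"
  then have "out_arcs G (tail G e) = {e}"
    using orbit_cyclic_eq3[OF rot_cyclic, of "tail G e" e] assms orbit_eq_singleton_iff[of rot e] by auto
  moreover obtain d where "d \<in> arcs G" "tail G d = tail G e" "d \<noteq> e"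
    using ex_third_arc[of "tail G e" e e] assms by auto
  ultimately show False by (metis in_out_arcs_conv singletonD)
qed

text \<open>
  If the third tail were the first one again, then the second oriented edge would be the reverse of
  the first by simplicity, and the rotation would fix it; but no vertex has degree 1.
\<close>

lemma face_tails_distinct:
  assumes d: "d \<in> arcs G"
  shows "tail G d \<noteq> tail G (\<phi> d)" "tail G (\<phi> d) \<noteq> tail G (\<phi> (\<phi> d))" "tail G d \<noteq> tail G (\<phi> (\<phi> d))"
proof -
  show "tail G d \<noteq> tail G (\<phi> d)" "tail G (\<phi> d) \<noteq> tail G (\<phi> (\<phi> d))"
    using d no_loops[of d] no_loops[of "\<phi> d"] by auto
  show "tail G d \<noteq> tail G (\<phi> (\<phi> d))"
  proof
    assume "tail G d = tail G (\<phi> (\<phi> d))"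
    then have "\<phi> d = arev d" using d by (intro arc_eqI) auto
    then show False using d rot_neq[of "arev d"] by (simp add: face_succ_def)
  qed
qed

lemma ex_consecutive_tail_notin:
  assumes "d \<in> arcs G" "finite X" "card X \<le> 2"
  shows "tail G d \<notin> X \<or> tail G (\<phi> d) \<notin> X \<or> tail G (\<phi> (\<phi> d)) \<notin> X"
proof (rule ccontr)
  assume "\<not> ?thesis"
  then have "{tail G d, tail G (\<phi> d), tail G (\<phi> (\<phi> d))} \<subseteq> X" by simp
  from card_mono[OF assms(2) this] show False
    using face_tails_distinct[OF assms(1)] assms(3) by (simp add: card_insert_if)
qed

text \<open>Three edges at a vertex, and one more at a neighbour that does not lead back.\<close>

lemma card_edges: "4 \<le> card (edges G arev)"
proof -
  obtain v where v: "v \<in> verts G" using has_edge tail_in_verts by blast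
  obtain e where e: "e \<in> arcs G" "tail G e = v" using ex_third_arc[OF v] .
  obtain e' where e': "e' \<in> arcs G" "tail G e' = v" "e' \<noteq> e" using ex_third_arc[OF v] .
  obtain e'' where e'': "e'' \<in> arcs G" "tail G e'' = v" "e'' \<noteq> e" "e'' \<noteq> e'" using ex_third_arc[OF v] .
  obtain d where d: "d \<in> arcs G" "tail G d = head G e" "head G d \<noteq> v"
    using ex_arc_avoiding_arc_and_vertex[of "head G e" _ v] e by auto
  have "card (edge_of arev ` {e, e', e'', d}) = card {e, e', e'', d}"
  proof (rule card_image, rule inj_onI)
    fix x y assume x: "x \<in> {e, e', e'', d}" and y: "y \<in> {e, e', e'', d}"
      and eq: "edge_of arev x = edge_of arev y"
    have "x = y \<or> x = arev y" using eq by (auto simp: edge_of_def)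
    moreover have "x \<noteq> arev y"
    proof
      assume "x = arev y"
      then have "tail G x = head G y" "head G x = tail G y"
        using y e e' e'' d by auto
      then show False
        using x y e e' e'' d no_loops[of e] no_loops[of e'] no_loops[of e''] no_loops[of d] by auto
    qed
    ultimately show "x = y" by simp
  qed
  also have "\<dots> = 4" using e e' e'' d no_loops[of e] by (auto simp: card_insert_if)
  finally have "card (edge_of arev ` {e, e', e'', d}) = 4" .
  moreover have "card (edge_of arev ` {e, e', e'', d}) \<le> card (edges G arev)"
    unfolding edges_def by (intro card_mono) (use e e' e'' d in auto)
  ultimately show ?thesis by simp
qed

lemma card_arcs: "4 \<le> card (arcs G)"
  using card_edges card_image_le[of "arcs G" "edge_of arev"] by (simp add: edges_def)

lemma card_ge_4_if_Base:
  fixes V :: "('v, 'd) op_vertex set"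
  assumes "finite V" "Base ` verts G \<subseteq> V"
  shows "4 \<le> card V"
proof -
  have "card ((Base :: 'v \<Rightarrow> ('v, 'd) op_vertex) ` verts G) = card (verts G)"
    by (intro card_image inj_onI) simp
  then show ?thesis
    using three_conn card_mono[OF assms] by (simp add: three_connected_def)
qed

text \<open>
  The common core of all seven cases: a path in \<open>G - X\<close> from \<open>u\<close> to \<open>v\<close> lifts to a path from
  the region of \<open>u\<close> to the region of \<open>v\<close>.
\<close>

lemma joined_by_regions:
  fixes K :: "'v \<Rightarrow> 'h set"
  assumes X: "finite X" "card X \<le> 2"
    and region: "\<And>v x y. v \<in> verts G - X \<Longrightarrow> x \<in> K v \<Longrightarrow> y \<in> K v \<Longrightarrow> joined E W x y"
    and link: "\<And>e. e \<in> arcs G \<Longrightarrow> tail G e \<notin> X \<Longrightarrow> head G e \<notin> X \<Longrightarrow>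
      \<exists>x\<in>K (tail G e). \<exists>y\<in>K (head G e). joined E W x y"
    and reach: "\<And>z. z \<in> W \<Longrightarrow> \<exists>v\<in>verts G - X. \<exists>x\<in>K v. joined E W z x"
    and z: "z \<in> W" "z' \<in> W"
  shows "joined E W z z'"
proof -
  let ?H = "G \<restriction> (verts G - X)"
  have regions: "joined E W x y"
    if u: "u \<in> verts G - X" and v: "v \<in> verts G - X" and x: "x \<in> K u" and y: "y \<in> K v" for u v x y
  proof -
    have "(u, v) \<in> rtrancl_on (verts G - X) ((arcs_ends ?H)\<^sup>s)"
      using connected_delete[OF X] u v by (auto simp: connected_conv)
    then have "\<forall>y\<in>K v. joined E W x y"
    proof (induction rule: rtrancl_on_induct)
      case base
      then show ?case using region[of u x] x by blast
    next
      case (step v w)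
      then obtain e where e: "e \<in> arcs G" "tail G e \<notin> X" "head G e \<notin> X"
        and ends: "v = tail G e \<and> w = head G e \<or> v = head G e \<and> w = tail G e"
        by (auto simp: symcl_def arcs_ends_conv)
      obtain p q where "p \<in> K v" "q \<in> K w" "joined E W p q"
        using link[OF e] ends joined_sym by metis
      moreover have "joined E W q y" if "y \<in> K w" for y
        using region[of w q y] step that \<open>q \<in> K w\<close> by blast
      ultimately show ?case
        using step.IH by (blast intro: joined_trans)
    qed
    then show ?thesis using y by blast
  qed
  obtain u x where u: "u \<in> verts G - X" "x \<in> K u" "joined E W z x" using reach[OF z(1)] by blast
  obtain v y where v: "v \<in> verts G - X" "y \<in> K v" "joined E W z' y" using reach[OF z(2)] by blast
  have "joined E W x y" using regions u v by blast
  then show ?thesis using u v by (meson joined_trans joined_sym)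
qed


section \<open>Truncation and snub\<close>

lemma three_connected_Truncation: "three_connected (Truncation G arev rot)"
  unfolding Truncation_def
proof (rule three_connected_multigraphI)
  let ?E = "{(Side 0 e, {e, rot e}) | e. e \<in> arcs G} \<union> {(Link p, p) | p. p \<in> edges G arev}"
  show "finite (arcs G)" "4 \<le> card (arcs G)" by (simp_all add: card_arcs)
  fix a b x y
  assume a: "a \<in> arcs G" and b: "b \<in> arcs G"
    and x: "x \<in> arcs G - {a, b}" and y: "y \<in> arcs G - {a, b}"
  let ?W = "arcs G - {a, b}" and ?X = "{tail G a, tail G b}"
  have side: "joined ?E ?W e (rot e)" if "e \<in> ?W" "rot e \<in> ?W" for e
    using that by (intro joined_edge[of "Side 0 e"]) auto
  have link: "joined ?E ?W e (arev e)" if "e \<in> ?W" "arev e \<in> ?W" for e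
    using that by (intro joined_edge[of "Link {e, arev e}"]) (auto simp: edges_def edge_of_def)
  have around: "joined ?E ?W e d"
    if "v \<in> verts G" "\<And>e. e \<in> arcs G \<Longrightarrow> tail G e = v \<Longrightarrow> e \<noteq> c \<Longrightarrow> e \<in> ?W"
      "e \<in> out_arcs G v" "e \<noteq> c" "d \<in> out_arcs G v" "d \<noteq> c" for v c e d
    using cyclic_minus_point_joined[OF rot_cyclic[OF that(1)], of c ?E ?W "\<lambda>e. e" e d] that side
    by auto
  show "joined ?E ?W x y"
  proof (rule joined_by_regions[where X = ?X and K = "out_arcs G"])
    show "card ?X \<le> 2" by (simp add: card_insert_if)
    show "joined ?E ?W e d" if "v \<in> verts G - ?X" "e \<in> out_arcs G v" "d \<in> out_arcs G v" for v e d
      using that a by (intro around[of v a]) auto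
    show "\<exists>x\<in>out_arcs G (tail G e). \<exists>y\<in>out_arcs G (head G e). joined ?E ?W x y"
      if "e \<in> arcs G" "tail G e \<notin> ?X" "head G e \<notin> ?X" for e
      using that by (intro bexI[of _ e] bexI[of _ "arev e"] link) auto
    fix z assume z: "z \<in> ?W"
    show "\<exists>v\<in>verts G - ?X. \<exists>x\<in>out_arcs G v. joined ?E ?W z x"
    proof (cases "tail G z \<in> ?X \<and> head G z \<in> ?X")
      case True
      \<comment> \<open>Then \<open>a\<close> and \<open>b\<close> start at different vertices, so the rotation at the tail of \<open>z\<close> is only cut once.\<close>
      define c where "c = (if tail G a = tail G z then a else b)"
      have c: "c \<in> {a, b}" "tail G c = tail G z"
        and X: "?X = {tail G z, head G z}"
        using True z no_loops[of z] by (auto simp: c_def)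
      have W: "e \<in> ?W" if "e \<in> arcs G" "tail G e = tail G z" "e \<noteq> c" for e
        using True z no_loops[of z] that by (auto simp: c_def split: if_splits)
      obtain d where d: "d \<in> arcs G" "tail G d = tail G z" "d \<noteq> c" "head G d \<noteq> head G z"
        using ex_arc_avoiding_arc_and_vertex[of "tail G z" c "head G z"] z by auto
      have "head G d \<notin> ?X" using d X no_loops[of d] by auto
      then have "arev d \<in> ?W" using d by auto
      moreover have "d \<in> ?W" using d W by blast
      moreover have "joined ?E ?W z d"
        using around[of "tail G z" c z d] W d z c by auto
      ultimately have "joined ?E ?W z (arev d)" using link[of d] by (blast intro: joined_trans)
      then show ?thesis using d \<open>head G d \<notin> ?X\<close>
        by (intro bexI[of _ "head G d"] bexI[of _ "arev d"]) auto
    next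
      case False
      then consider "tail G z \<notin> ?X" | "head G z \<notin> ?X" by blast
      then show ?thesis
      proof cases
        case 1
        then show ?thesis using z by (intro bexI[of _ "tail G z"] bexI[of _ z]) auto
      next
        case 2
        then have "arev z \<in> ?W" using z by auto
        then show ?thesis using 2 z link[of z]
          by (intro bexI[of _ "head G z"] bexI[of _ "arev z"]) auto
      qed
    qed
  qed (use x y in auto)
qed

lemma three_connected_Snub: "three_connected (Snub G arev rot)"
  using three_connected_Truncation unfolding Truncation_def Snub_def
  by (rule three_connected_multigraph_mono) auto

section \<open>Leapfrog\<close>

text \<open>
  The closed walk $e_1, e_1^{-1}, e_2, e_2^{-1}, \<dots>$ around \<open>v\<close>, where $e_1, e_2, \<dots>$ are the
  oriented edges at \<open>v\<close> in cyclic order: it is a cycle of Leapfrog since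
  $\<phi>(e_i^{-1}) = \<sigma>(e_i) = e_{i+1}$.
\<close>

lemma cyclic_on_incident_arcs:
  assumes v: "v \<in> verts G"
  shows "cyclic_on (\<lambda>e. if tail G e = v then arev e else \<phi> e) {e \<in> arcs G. tail G e = v \<or> head G e = v}"
    (is "cyclic_on _ ?C")
proof -
  define g where "g e = (if tail G e = v then arev e else \<phi> e)" for e
  obtain s where s: "s \<in> arcs G" "tail G s = v" using ex_third_arc[OF v] .
  have gg: "g (g e) = rot e" if "e \<in> out_arcs G v" for e
    using that no_loops[of e] by (auto simp: g_def face_succ_def)
  have out: "out_arcs G v = orbit rot s"
    using orbit_cyclic_eq3[OF rot_cyclic[OF v], of s] s by simp
  have rots: "e \<in> orbit g s" if "e \<in> orbit rot s" for e
    using that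
  proof induction
    case base
    have "g (g s) \<in> orbit g s" by (intro orbit.intros)
    then show ?case using gg[of s] s by simp
  next
    case (step e)
    have "g (g e) \<in> orbit g s" using step.IH by (intro orbit.step)
    then show ?case using gg[of e] step.hyps out by simp
  qed
  have "e \<in> orbit g s" if "e \<in> ?C" for e
  proof (cases "tail G e = v")
    case True
    then have "e \<in> out_arcs G v" using that by simp
    then show ?thesis using rots unfolding out by blast
  next
    case False
    then have "arev e \<in> out_arcs G v" using that by auto
    then have "g (arev e) \<in> orbit g s" using rots out by (intro orbit.step) auto
    then show ?thesis using False that by (simp add: g_def)
  qed
  moreover have "e \<in> ?C" if "e \<in> orbit g s" for e
    using that s by induction (auto simp: g_def)
  ultimately have "?C = orbit g s" by blast
  then have "cyclic_on g ?C" using s by (intro cyclic_on_singleI[of s]) auto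
  then show ?thesis unfolding g_def .
qed

lemma three_connected_Leapfrog: "three_connected (Leapfrog G arev rot)"
  unfolding Leapfrog_def
proof (rule three_connected_multigraphI)
  let ?E = "{(Side 0 e, {e, \<phi> e}) | e. e \<in> arcs G} \<union> {(Link p, p) | p. p \<in> edges G arev}"
  show "finite (arcs G)" "4 \<le> card (arcs G)" by (simp_all add: card_arcs)
  fix a b x y
  assume a: "a \<in> arcs G" and b: "b \<in> arcs G" and ab: "a \<noteq> b"
    and x: "x \<in> arcs G - {a, b}" and y: "y \<in> arcs G - {a, b}"
  let ?W = "arcs G - {a, b}"
  let ?C = "\<lambda>v. {e \<in> arcs G. tail G e = v \<or> head G e = v}"
  let ?X = "{v. a \<in> ?C v \<and> b \<in> ?C v}"
  have X: "?X \<subseteq> {tail G a, head G a}" by auto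
  have side: "joined ?E ?W e (\<phi> e)" if "e \<in> ?W" "\<phi> e \<in> ?W" for e
    using that by (intro joined_edge[of "Side 0 e"]) auto
  have link: "joined ?E ?W e (arev e)" if "e \<in> ?W" "arev e \<in> ?W" for e
    using that by (intro joined_edge[of "Link {e, arev e}"]) (auto simp: edges_def edge_of_def)
  show "joined ?E ?W x y"
  proof (rule joined_by_regions[where X = ?X and K = "\<lambda>v. ?C v - {a, b}"])
    show "finite ?X" using X finite_subset by blast
    show "card ?X \<le> 2"
      using card_mono[OF _ X] by (simp add: card_insert_if split: if_splits)
    show "joined ?E ?W e d" if v: "v \<in> verts G - ?X" and e: "e \<in> ?C v - {a, b}" and d: "d \<in> ?C v - {a, b}"
      for v e d
    proof -
      define c where "c = (if a \<in> ?C v then a else b)"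
      have W: "e \<in> ?W" if "e \<in> ?C v" "e \<noteq> c" for e
        using that v a by (auto simp: c_def split: if_splits)
      let ?g = "\<lambda>e. if tail G e = v then arev e else \<phi> e"
      have cyc: "cyclic_on ?g (?C v)" using cyclic_on_incident_arcs v by simp
      show ?thesis
      proof (rule cyclic_minus_point_joined[OF cyc, of c _ _ "\<lambda>e. e"])
        fix h assume h: "h \<in> ?C v" "h \<noteq> c" "?g h \<noteq> c"
        then have "h \<in> ?W" "?g h \<in> ?W" using W cyclic_on_inI[OF cyc, of h] by blast+
        then show "joined ?E ?W h (?g h)" using side[of h] link[of h] by presburger
      qed (use e d in \<open>auto simp: c_def\<close>)
    qed
    show "\<exists>x\<in>?C (tail G e) - {a, b}. \<exists>y\<in>?C (head G e) - {a, b}. joined ?E ?W x y"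
      if e: "e \<in> arcs G" "tail G e \<notin> ?X" for e
    proof -
      \<comment> \<open>Both orientations belong to both regions; if both are deleted, then the ends of \<open>e\<close> are in \<open>?X\<close>.\<close>
      have "e \<notin> {a, b} \<or> arev e \<notin> {a, b}" using e ab arev_neq[of e] by auto
      then obtain h where "h \<in> {e, arev e}" "h \<notin> {a, b}" by blast
      then show ?thesis using e by (intro bexI[of _ h]) auto
    qed
    fix z assume z: "z \<in> ?W"
    \<comment> \<open>Otherwise \<open>a\<close> and \<open>b\<close> both join the two ends of \<open>z\<close>, which leaves only one possibility for them.\<close>
    have "tail G z \<notin> ?X \<or> head G z \<notin> ?X"
    proof (rule ccontr)
      assume "\<not> ?thesis"
      moreover have "d = z \<or> d = arev z"
        if "d \<in> ?C (tail G z)" "d \<in> ?C (head G z)" for d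
        using that z no_loops[of z] arc_eqI[of d z] arc_eqI[of d "arev z"] by auto
      ultimately have "a = arev z" "b = arev z" using z by blast+
      then show False using ab by simp
    qed
    then show "\<exists>v\<in>verts G - ?X. \<exists>x\<in>?C v - {a, b}. joined ?E ?W z x"
      using z by (metis (mono_tags, lifting) Diff_iff head_in_verts joined_refl mem_Collect_eq tail_in_verts)
  qed (use x y in auto)
qed


section \<open>Ambo\<close>

lemma edge_of_arev [simp]: "edge_of arev (arev e) = edge_of arev e"
  by (auto simp: edge_of_def)

lemma edge_of_eq_iff: "edge_of arev d = edge_of arev e \<longleftrightarrow> d = e \<or> d = arev e"
  by (auto simp: edge_of_def doubleton_eq_iff)

text \<open>
  Orienting the two deleted edges away from their common end, if there is one, allows \<open>X\<close> to be the
  set of their tails in either case: no cycle around a vertex outside \<open>X\<close> contains both of them.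
\<close>

lemma edges_represented:
  assumes "A \<in> edges G arev" "B \<in> edges G arev" "A \<noteq> B"
  obtains a b where "a \<in> arcs G" "b \<in> arcs G" "A = edge_of arev a" "B = edge_of arev b"
    "head G a \<noteq> head G b" "tail G a = tail G b \<or> tail G a \<noteq> head G b \<and> head G a \<noteq> tail G b"
proof -
  obtain a b where ab: "a \<in> arcs G" "b \<in> arcs G" "A = edge_of arev a" "B = edge_of arev b"
    using assms by (auto simp: edges_def)
  have diff: "a \<noteq> b" "arev a \<noteq> b" "a \<noteq> arev b" using assms(3) ab by (auto simp: edge_of_arev)
  have heads: "head G c \<noteq> head G d"
    if "c \<in> {a, arev a}" "d \<in> {b, arev b}" "tail G c = tail G d" for c d
    using that ab diff arc_eqI[of c d] by (auto simp: arev_eq_iff)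
  show ?thesis
  proof (cases "tail G a = tail G b")
    case True
    then show ?thesis using that[of a b] ab heads[of a b] by simp
  next
    case tt: False
    show ?thesis
    proof (cases "head G a = head G b")
      case True
      then show ?thesis using that[of "arev a" "arev b"] ab tt by simp
    next
      case hh: False
      show ?thesis
      proof (cases "tail G a = head G b")
        case True
        then show ?thesis using that[of a "arev b"] ab heads[of a "arev b"] by simp
      next
        case th: False
        show ?thesis
        proof (cases "head G a = tail G b")
          case True
          then show ?thesis using that[of "arev a" b] ab heads[of "arev a" b] by simp
        next
          case False
          then show ?thesis using that[of a b] ab hh th by simp
        qed
      qed
    qed
  qed
qed

lemma three_connected_Ambo: "three_connected (Ambo G arev rot)"
  unfolding Ambo_def
proof (rule three_connected_multigraphI)
  let ?E = "{(Side 0 e, {edge_of arev e, edge_of arev (rot e)}) | e. e \<in> arcs G}"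
  show "finite (edges G arev)" "4 \<le> card (edges G arev)"
    using card_edges by (simp_all add: edges_def)
  fix A B x y
  assume AB: "A \<in> edges G arev" "B \<in> edges G arev" "A \<noteq> B"
    and x: "x \<in> edges G arev - {A, B}" and y: "y \<in> edges G arev - {A, B}"
  let ?W = "edges G arev - {A, B}"
  obtain a b where a: "a \<in> arcs G" "A = edge_of arev a" and b: "b \<in> arcs G" "B = edge_of arev b"
    and heads: "head G a \<noteq> head G b"
    and cross: "tail G a = tail G b \<or> tail G a \<noteq> head G b \<and> head G a \<noteq> tail G b"
    using edges_represented[OF AB] by metis
  let ?X = "{tail G a, tail G b}" and ?K = "\<lambda>v. edge_of arev ` out_arcs G v - {A, B}"
  have deleted: "d \<in> {a, arev a, b, arev b}" if "edge_of arev d \<in> {A, B}" for d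
    using that a b by (auto simp: edge_of_eq_iff)
  have side: "joined ?E ?W (edge_of arev e) (edge_of arev (rot e))"
    if "e \<in> arcs G" "edge_of arev e \<notin> {A, B}" "edge_of arev (rot e) \<notin> {A, B}" for e
    using that by (intro joined_edge[of "Side 0 e"]) (auto simp: edges_def)
  have around: "joined ?E ?W (edge_of arev e) (edge_of arev d)"
    if "v \<in> verts G" "\<And>e. e \<in> out_arcs G v \<Longrightarrow> e \<noteq> c \<Longrightarrow> edge_of arev e \<notin> {A, B}"
      "e \<in> out_arcs G v" "e \<noteq> c" "d \<in> out_arcs G v" "d \<noteq> c" for v c e d
  proof (rule cyclic_minus_point_joined[OF rot_cyclic[OF that(1)], of c ?E ?W "edge_of arev"])
    fix h assume h: "h \<in> out_arcs G v" "h \<noteq> c" "rot h \<noteq> c"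
    then have "rot h \<in> out_arcs G v" by simp
    then show "joined ?E ?W (edge_of arev h) (edge_of arev (rot h))"
      using side that(2) h by simp
  qed (use that in auto)
  show "joined ?E ?W x y"
  proof (rule joined_by_regions[where X = ?X and K = ?K])
    show "card ?X \<le> 2" by (simp add: card_insert_if)
    show "joined ?E ?W p q" if v: "v \<in> verts G - ?X" and p: "p \<in> ?K v" and q: "q \<in> ?K v" for v p q
    proof -
      define c where "c = (if v = head G a then arev a else arev b)"
      have c: "edge_of arev c \<in> {A, B}" using a b by (auto simp: c_def)
      have keep: "edge_of arev e \<notin> {A, B}" if "e \<in> out_arcs G v" "e \<noteq> c" for e
        using that v deleted[of e] heads a b by (auto simp: c_def split: if_splits)
      obtain e d where "p = edge_of arev e" "q = edge_of arev d" "e \<in> out_arcs G v" "d \<in> out_arcs G v"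
        using p q by blast
      then show ?thesis using around[of v c e d] keep v p q c by blast
    qed
    have region: "edge_of arev e \<in> ?K (tail G e)" "edge_of arev e \<in> ?K (head G e)"
      if "e \<in> arcs G" "edge_of arev e \<notin> {A, B}" for e
      using that imageI[of "arev e" "out_arcs G (head G e)" "edge_of arev"] by auto
    show "\<exists>p\<in>?K (tail G e). \<exists>q\<in>?K (head G e). joined ?E ?W p q"
      if e: "e \<in> arcs G" "tail G e \<notin> ?X" "head G e \<notin> ?X" for e
    proof -
      have "edge_of arev e \<notin> {A, B}" using e deleted[of e] a b by auto
      then show ?thesis
        using region[OF e(1)] by (intro bexI[of _ "edge_of arev e"] joined_refl) auto
    qed
    fix z assume z: "z \<in> ?W"
    \<comment> \<open>The hypotheses force \<open>a\<close> and \<open>b\<close> to be disjoint, so that the cycle around the tail of \<open>a\<close> loses \<open>a\<close> only.\<close>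
    have escape: "\<exists>v\<in>verts G - ?X. \<exists>x\<in>?K v. joined ?E ?W (edge_of arev e) x"
      if e: "e \<in> arcs G" "edge_of arev e \<notin> {A, B}"
        and u: "tail G e = tail G a" "head G e = tail G b" for e
    proof -
      have ne: "tail G a \<noteq> tail G b" using e u no_loops[of e] by auto
      obtain d where d: "d \<in> arcs G" "tail G d = tail G a" "d \<noteq> a" "head G d \<noteq> tail G b"
        using ex_arc_avoiding_arc_and_vertex[of "tail G a" a "tail G b"] a by auto
      have keep: "edge_of arev h \<notin> {A, B}" if "h \<in> out_arcs G (tail G a)" "h \<noteq> a" for h
        using that deleted[of h] ne cross no_loops[of a] a b by auto
      have "e \<noteq> a" using e a by auto
      then have "joined ?E ?W (edge_of arev e) (edge_of arev d)"
        using around[of "tail G a" a e d] keep a e d u by simp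
      moreover have "edge_of arev d \<in> ?K (head G d)" using region(2)[of d] keep[of d] d by simp
      moreover have "head G d \<in> verts G - ?X" using d no_loops[of d] by auto
      ultimately show ?thesis by blast
    qed
    obtain e where e: "e \<in> arcs G" "z = edge_of arev e" using z by (auto simp: edges_def)
    then have alive: "edge_of arev e \<notin> {A, B}" using z by blast
    show "\<exists>v\<in>verts G - ?X. \<exists>x\<in>?K v. joined ?E ?W z x"
    proof (cases "tail G e \<in> ?X \<and> head G e \<in> ?X")
      case True
      then have "tail G e = tail G a \<and> head G e = tail G b \<or> tail G e = tail G b \<and> head G e = tail G a"
        using no_loops[OF e(1)] by auto
      then show ?thesis using escape[of e] escape[of "arev e"] e alive by auto
    next
      case False
      then have "tail G e \<in> verts G - ?X \<or> head G e \<in> verts G - ?X" using e by auto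
      then obtain v where "v \<in> {tail G e, head G e}" "v \<in> verts G - ?X" by blast
      then show ?thesis
        using region[OF e(1) alive] e(2) by (intro bexI[of _ v] bexI[of _ z] joined_refl) auto
    qed
  qed (use x y in auto)
qed

section \<open>Chamfer, gyro and capra\<close>

text \<open>
  The vertices of \<open>G\<close> whose region is damaged when the given vertex is deleted. No region contains
  a face centre.
\<close>

primrec anchors :: "('v, 'd) op_vertex \<Rightarrow> 'v set" where
  "anchors (Base v) = {v}"
| "anchors (Face f) = {}"
| "anchors (Pt e) = {tail G e}"
| "anchors (Qt e) = {tail G e}"

lemma anchors_le_1: "finite (anchors z)" "card (anchors z) \<le> 1"
  by (cases z; simp)+

lemma card_anchors: "finite (anchors a \<union> anchors b)" "card (anchors a \<union> anchors b) \<le> 2"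
  using anchors_le_1[of a] anchors_le_1[of b] card_Un_le[of "anchors a" "anchors b"] by auto

text \<open>Each deleted vertex belongs to at most one of the at least three oriented edges at \<open>v\<close>.\<close>

lemma ex_arc_untouched:
  fixes a b :: "('v, 'd) op_vertex"
  assumes "v \<in> verts G"
  obtains e where "e \<in> arcs G" "tail G e = v" "Pt e \<notin> {a, b}" "Qt e \<notin> {a, b}"
proof -
  define lab where "lab z = (case z of Pt d \<Rightarrow> d | Qt d \<Rightarrow> d | _ \<Rightarrow> undefined)" for z :: "('v, 'd) op_vertex"
  obtain e where "e \<in> arcs G" "tail G e = v" "e \<noteq> lab a" "e \<noteq> lab b"
    using ex_third_arc[OF assms] .
  then show ?thesis using that[of e] by (force simp: lab_def)
qed

lemma three_connected_Chamfer: "three_connected (Chamfer G arev rot)"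
  unfolding Chamfer_def
proof (rule three_connected_multigraphI)
  let ?V = "Base ` verts G \<union> Pt ` arcs G"
  let ?E = "{(Side 0 e, {Base (tail G e), Pt e}) | e. e \<in> arcs G} \<union>
     {(Side 1 e, {Pt e, Pt (\<phi> e)}) | e. e \<in> arcs G}"
  show "finite ?V" by simp
  then show "4 \<le> card ?V" by (rule card_ge_4_if_Base) simp
  fix a b x y
  assume x: "x \<in> ?V - {a, b}" and y: "y \<in> ?V - {a, b}"
  let ?W = "?V - {a, b}" and ?X = "anchors a \<union> anchors b"
    and ?K = "\<lambda>v. insert (Base v) (Pt ` out_arcs G v)"
  let ?R = "\<lambda>z. \<exists>v\<in>verts G - ?X. \<exists>x\<in>?K v. joined ?E ?W z x"
  have via: "?R p" if pq: "joined ?E ?W p q" and q: "?R q" for p q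
  proof -
    obtain v x where "v \<in> verts G - ?X" "x \<in> ?K v" "joined ?E ?W q x" using q by blast
    then show ?thesis using joined_trans[OF pq, of x] by blast
  qed
  have spoke: "joined ?E ?W (Base (tail G e)) (Pt e)"
    if "e \<in> arcs G" "Base (tail G e) \<notin> {a, b}" "Pt e \<notin> {a, b}" for e
    using that by (intro joined_edge[of "Side 0 e"]) auto
  have side: "joined ?E ?W (Pt e) (Pt (\<phi> e))"
    if "e \<in> arcs G" "Pt e \<notin> {a, b}" "Pt (\<phi> e) \<notin> {a, b}" for e
    using that by (intro joined_edge[of "Side 1 e"]) auto
  have alive: "Base v \<notin> {a, b}" if "v \<notin> ?X" for v
    using that by auto
  have alive_Pt: "Pt e \<notin> {a, b}" if "tail G e \<notin> ?X" for e
    using that by auto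
  show "joined ?E ?W x y"
  proof (rule joined_by_regions[where X = ?X and K = ?K])
    show "finite ?X" "card ?X \<le> 2" by (rule card_anchors)+
    show "joined ?E ?W p q" if v: "v \<in> verts G - ?X" and p: "p \<in> ?K v" and q: "q \<in> ?K v" for v p q
    proof -
      have "joined ?E ?W (Base v) p" if "p \<in> ?K v" for p
        using that v alive[of v] alive_Pt spoke by auto
      then show ?thesis using p q by (blast intro: joined_trans joined_sym)
    qed
    show "\<exists>p\<in>?K (tail G e). \<exists>q\<in>?K (head G e). joined ?E ?W p q"
      if "e \<in> arcs G" "tail G e \<notin> ?X" "head G e \<notin> ?X" for e
      using that alive_Pt[of e] alive_Pt[of "\<phi> e"]
      by (intro bexI[of _ "Pt e"] bexI[of _ "Pt (\<phi> e)"] side) auto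
    \<comment> \<open>One of \<open>e\<close> and its two neighbours on its face starts outside \<open>?X\<close>.\<close>
    have escape: "?R (Pt e)"
      if e: "e \<in> arcs G" "Pt e \<notin> {a, b}" for e
    proof -
      have near: ?thesis if "h \<in> arcs G" "tail G h \<notin> ?X" "joined ?E ?W (Pt e) (Pt h)" for h
        using that by (intro bexI[of _ "tail G h"] bexI[of _ "Pt h"]) auto
      obtain d where d: "d \<in> arcs G" "\<phi> d = e" using phi_predE[OF e(1)] .
      consider "tail G d \<notin> ?X" | "tail G e \<notin> ?X" | "tail G (\<phi> e) \<notin> ?X"
        using ex_consecutive_tail_notin[OF d(1) card_anchors] d(2) by blast
      then show ?thesis
      proof cases
        case 1
        have "joined ?E ?W (Pt d) (Pt e)" using side[of d] alive_Pt[OF 1] d e by simp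
        then show ?thesis by (rule near[OF d(1) 1 joined_sym])
      next
        case 2
        then show ?thesis using near[of e] e by simp
      next
        case 3
        then show ?thesis using near[of "\<phi> e"] side[of e] alive_Pt[OF 3] e by simp
      qed
    qed
    fix z assume z: "z \<in> ?W"
    then consider v where "v \<in> verts G" "z = Base v" | e where "e \<in> arcs G" "z = Pt e" by auto
    then show "?R z"
    proof cases
      case 1
      obtain e where e: "e \<in> arcs G" "tail G e = v" "Pt e \<notin> {a, b}"
        using ex_arc_untouched[OF 1(1), of a b] by metis
      have "joined ?E ?W z (Pt e)" using spoke[of e] e 1 z by simp
      then show ?thesis using escape[OF e(1,3)] by (rule via)
    next
      case 2
      then show ?thesis using escape[of e] z by simp
    qed
  qed (use x y in auto)
qed

lemma three_connected_Gyro: "three_connected (Gyro G arev rot)"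
  unfolding Gyro_def
proof (rule three_connected_multigraphI)
  let ?V = "Base ` verts G \<union> Face ` faces G arev rot \<union> Pt ` arcs G"
  let ?E = "{(Side 0 e, {Base (tail G e), Pt e}) | e. e \<in> arcs G} \<union>
     {(Side 1 e, {Face (face_of arev rot e), Pt e}) | e. e \<in> arcs G} \<union>
     {(Link p, Pt ` p) | p. p \<in> edges G arev}"
  show "finite ?V" by (simp add: faces_def)
  then show "4 \<le> card ?V" by (rule card_ge_4_if_Base) auto
  fix a b x y
  assume ab: "a \<noteq> b" and x: "x \<in> ?V - {a, b}" and y: "y \<in> ?V - {a, b}"
  let ?W = "?V - {a, b}" and ?X = "anchors a \<union> anchors b"
    and ?K = "\<lambda>v. insert (Base v) (Pt ` out_arcs G v)"
  let ?R = "\<lambda>z. \<exists>v\<in>verts G - ?X. \<exists>x\<in>?K v. joined ?E ?W z x"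
  have via: "?R p" if pq: "joined ?E ?W p q" and q: "?R q" for p q
  proof -
    obtain v x where "v \<in> verts G - ?X" "x \<in> ?K v" "joined ?E ?W q x" using q by blast
    then show ?thesis using joined_trans[OF pq, of x] by blast
  qed
  let ?F = "\<lambda>e. Face (face_of arev rot e) :: ('v, 'd) op_vertex"
  have spoke: "joined ?E ?W (Base (tail G e)) (Pt e)"
    if "e \<in> arcs G" "Base (tail G e) \<notin> {a, b}" "Pt e \<notin> {a, b}" for e
    using that by (intro joined_edge[of "Side 0 e"]) auto
  have centre: "joined ?E ?W (?F e) (Pt e)"
    if "e \<in> arcs G" "?F e \<notin> {a, b}" "Pt e \<notin> {a, b}" for e
    using that by (intro joined_edge[of "Side 1 e"]) (auto simp: faces_def)
  have link: "joined ?E ?W (Pt e) (Pt (arev e))"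
    if "e \<in> arcs G" "Pt e \<notin> {a, b}" "Pt (arev e) \<notin> {a, b}" for e
    using that by (intro joined_edge[of "Link {e, arev e}"]) (auto simp: edges_def edge_of_def)
  have alive: "Base v \<notin> {a, b}" if "v \<notin> ?X" for v
    using that by auto
  have alive_Pt: "Pt e \<notin> {a, b}" if "tail G e \<notin> ?X" for e
    using that by auto
  show "joined ?E ?W x y"
  proof (rule joined_by_regions[where X = ?X and K = ?K])
    show "finite ?X" "card ?X \<le> 2" by (rule card_anchors)+
    show "joined ?E ?W p q" if v: "v \<in> verts G - ?X" and p: "p \<in> ?K v" and q: "q \<in> ?K v" for v p q
    proof -
      have "joined ?E ?W (Base v) p" if "p \<in> ?K v" for p
        using that v alive[of v] alive_Pt spoke by auto
      then show ?thesis using p q by (blast intro: joined_trans joined_sym)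
    qed
    show "\<exists>p\<in>?K (tail G e). \<exists>q\<in>?K (head G e). joined ?E ?W p q"
      if "e \<in> arcs G" "tail G e \<notin> ?X" "head G e \<notin> ?X" for e
      using that alive_Pt[of e] alive_Pt[of "arev e"]
      by (intro bexI[of _ "Pt e"] bexI[of _ "Pt (arev e)"] link) auto
    have near: "?R z"
      if "h \<in> arcs G" "tail G h \<notin> ?X" "joined ?E ?W z (Pt h)" for h z
      using that by (intro bexI[of _ "tail G h"] bexI[of _ "Pt h"]) auto
    have escape_Face: "?R (?F e)"
      if e: "e \<in> arcs G" "?F e \<notin> {a, b}" for e
    proof -
      obtain h where h: "h \<in> {e, \<phi> e, \<phi> (\<phi> e)}" "tail G h \<notin> ?X"
        using ex_consecutive_tail_notin[OF e(1) card_anchors[of a b]] by blast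
      then have "h \<in> arcs G" "?F h = ?F e" using e by auto
      then have "joined ?E ?W (?F e) (Pt h)" using centre[of h] alive_Pt[OF h(2)] e by simp
      then show ?thesis by (rule near[OF \<open>h \<in> arcs G\<close> h(2)])
    qed
    have escape_Pt: "?R (Pt e)"
      if e: "e \<in> arcs G" "Pt e \<notin> {a, b}" for e
    proof (cases "?F e \<in> {a, b}")
      case False
      show ?thesis
        by (rule via[OF joined_sym[OF centre[OF e(1) False e(2)]] escape_Face[OF e(1) False]])
    next
      case True
      \<comment> \<open>A deleted face centre has no anchor, so that \<open>?X\<close> has at most one element.\<close>
      then have "\<exists>w. ?X \<subseteq> {w}" by (cases a; cases b) auto
      then have "tail G e \<notin> ?X \<or> head G e \<notin> ?X" using no_loops[OF e(1)] by auto
      then show ?thesis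
      proof
        assume "tail G e \<notin> ?X"
        then show ?thesis using near[of e "Pt e"] e by simp
      next
        assume "head G e \<notin> ?X"
        then show ?thesis
          using near[of "arev e" "Pt e"] link[of e] alive_Pt[of "arev e"] e by simp
      qed
    qed
    fix z assume z: "z \<in> ?W"
    then consider v where "v \<in> verts G" "z = Base v" | e where "e \<in> arcs G" "z = Pt e"
      | e where "e \<in> arcs G" "z = ?F e" by (auto simp: faces_def)
    then show "?R z"
    proof cases
      case 1
      obtain e where e: "e \<in> arcs G" "tail G e = v" "Pt e \<notin> {a, b}"
        using ex_arc_untouched[OF 1(1), of a b] by metis
      have "joined ?E ?W z (Pt e)" using spoke[of e] e 1 z by simp
      then show ?thesis using escape_Pt[OF e(1,3)] by (rule via)
    next
      case 2
      then show ?thesis using escape_Pt[of e] z by simp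
    next
      case 3
      then show ?thesis using escape_Face[of e] z by simp
    qed
  qed (use x y in auto)
qed

lemma three_connected_Capra: "three_connected (Capra G arev rot)"
  unfolding Capra_def
proof (rule three_connected_multigraphI)
  let ?V = "Base ` verts G \<union> Pt ` arcs G \<union> Qt ` arcs G"
  let ?E = "{(Side 0 e, {Base (tail G e), Pt e}) | e. e \<in> arcs G} \<union>
     {(Side 1 e, {Pt e, Qt e}) | e. e \<in> arcs G} \<union>
     {(Side 2 e, {Qt e, Qt (\<phi> e)}) | e. e \<in> arcs G} \<union>
     {(Link p, Pt ` p) | p. p \<in> edges G arev}"
  show "finite ?V" by simp
  then show "4 \<le> card ?V" by (rule card_ge_4_if_Base) auto
  fix a b x y
  assume x: "x \<in> ?V - {a, b}" and y: "y \<in> ?V - {a, b}"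
  let ?W = "?V - {a, b}" and ?X = "anchors a \<union> anchors b"
    and ?K = "\<lambda>v. insert (Base v) (Pt ` out_arcs G v \<union> Qt ` out_arcs G v)"
  let ?R = "\<lambda>z. \<exists>v\<in>verts G - ?X. \<exists>x\<in>?K v. joined ?E ?W z x"
  have via: "?R p" if pq: "joined ?E ?W p q" and q: "?R q" for p q
  proof -
    obtain v x where "v \<in> verts G - ?X" "x \<in> ?K v" "joined ?E ?W q x" using q by blast
    then show ?thesis using joined_trans[OF pq, of x] by blast
  qed
  have spoke: "joined ?E ?W (Base (tail G e)) (Pt e)"
    if "e \<in> arcs G" "Base (tail G e) \<notin> {a, b}" "Pt e \<notin> {a, b}" for e
    using that by (intro joined_edge[of "Side 0 e"]) auto
  have stem: "joined ?E ?W (Pt e) (Qt e)"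
    if "e \<in> arcs G" "Pt e \<notin> {a, b}" "Qt e \<notin> {a, b}" for e
    using that by (intro joined_edge[of "Side 1 e"]) auto
  have side: "joined ?E ?W (Qt e) (Qt (\<phi> e))"
    if "e \<in> arcs G" "Qt e \<notin> {a, b}" "Qt (\<phi> e) \<notin> {a, b}" for e
    using that by (intro joined_edge[of "Side 2 e"]) auto
  have link: "joined ?E ?W (Pt e) (Pt (arev e))"
    if "e \<in> arcs G" "Pt e \<notin> {a, b}" "Pt (arev e) \<notin> {a, b}" for e
    using that by (intro joined_edge[of "Link {e, arev e}"]) (auto simp: edges_def edge_of_def)
  have alive: "Base v \<notin> {a, b}" if "v \<notin> ?X" for v
    using that by auto
  have alive_Pt: "Pt e \<notin> {a, b}" and alive_Qt: "Qt e \<notin> {a, b}" if "tail G e \<notin> ?X" for e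
    using that by auto
  show "joined ?E ?W x y"
  proof (rule joined_by_regions[where X = ?X and K = ?K])
    show "finite ?X" "card ?X \<le> 2" by (rule card_anchors)+
    show "joined ?E ?W p q" if v: "v \<in> verts G - ?X" and p: "p \<in> ?K v" and q: "q \<in> ?K v" for v p q
    proof -
      have Pt: "joined ?E ?W (Base v) (Pt e)" if "e \<in> out_arcs G v" for e
        using that v alive[of v] alive_Pt[of e] spoke[of e] by simp
      have Qt: "joined ?E ?W (Base v) (Qt e)" if "e \<in> out_arcs G v" for e
        using Pt[OF that] stem[of e] that v alive_Pt[of e] alive_Qt[of e] by (auto intro: joined_trans)
      have "joined ?E ?W (Base v) p" if "p \<in> ?K v" for p
        using that Pt Qt by auto
      then show ?thesis using p q by (blast intro: joined_trans joined_sym)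
    qed
    show "\<exists>p\<in>?K (tail G e). \<exists>q\<in>?K (head G e). joined ?E ?W p q"
      if "e \<in> arcs G" "tail G e \<notin> ?X" "head G e \<notin> ?X" for e
      using that alive_Pt[of e] alive_Pt[of "arev e"]
      by (intro bexI[of _ "Pt e"] bexI[of _ "Pt (arev e)"] link) auto
    have near_Pt: "?R z"
      if "h \<in> arcs G" "tail G h \<notin> ?X" "joined ?E ?W z (Pt h)" for h z
      using that by (intro bexI[of _ "tail G h"] bexI[of _ "Pt h"]) auto
    have near_Qt: "?R z"
      if "h \<in> arcs G" "tail G h \<notin> ?X" "joined ?E ?W z (Qt h)" for h z
      using that by (intro bexI[of _ "tail G h"] bexI[of _ "Qt h"]) auto
    \<comment> \<open>One of \<open>e\<close> and its two neighbours on its face starts outside \<open>?X\<close>.\<close>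
    have escape_Qt: "?R (Qt e)"
      if e: "e \<in> arcs G" "Qt e \<notin> {a, b}" for e
    proof -
      obtain d where d: "d \<in> arcs G" "\<phi> d = e" using phi_predE[OF e(1)] .
      consider "tail G d \<notin> ?X" | "tail G e \<notin> ?X" | "tail G (\<phi> e) \<notin> ?X"
        using ex_consecutive_tail_notin[OF d(1) card_anchors] d(2) by blast
      then show ?thesis
      proof cases
        case 1
        have "joined ?E ?W (Qt d) (Qt e)" using side[of d] alive_Qt[OF 1] d e by simp
        then show ?thesis by (rule near_Qt[OF d(1) 1 joined_sym])
      next
        case 2
        then show ?thesis using near_Qt[of e] e by simp
      next
        case 3
        then show ?thesis using near_Qt[of "\<phi> e"] side[of e] alive_Qt[OF 3] e by simp
      qed
    qed
    have escape_Base: "?R (Base v)"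
      if v: "v \<in> verts G" "Base v \<notin> {a, b}" for v
    proof -
      obtain e where e: "e \<in> arcs G" "tail G e = v" "Pt e \<notin> {a, b}" "Qt e \<notin> {a, b}"
        using ex_arc_untouched[OF v(1)] .
      have "joined ?E ?W (Base v) (Qt e)"
        using spoke[of e] stem[of e] e v by (auto intro: joined_trans)
      then show ?thesis using escape_Qt[OF e(1,4)] by (rule via)
    qed
    have escape_Pt: "?R (Pt e)"
      if e: "e \<in> arcs G" "Pt e \<notin> {a, b}" for e
    proof (cases "Qt e \<in> {a, b}")
      case False
      show ?thesis by (rule via[OF stem[OF e False] escape_Qt[OF e(1) False]])
    next
      case Qt: True
      show ?thesis
      proof (cases "head G e \<in> ?X")
        case False
        then show ?thesis
          using near_Pt[of "arev e" "Pt e"] link[of e] alive_Pt[of "arev e"] e by simp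
      next
        case True
        \<comment> \<open>The vertex deleted besides \<open>Qt e\<close> is anchored at the head of \<open>e\<close>, so the tail of \<open>e\<close> survives.\<close>
        then have "Base (tail G e) \<notin> {a, b}" using Qt no_loops[OF e(1)] by auto
        then show ?thesis
          using via[OF joined_sym[OF spoke[OF e(1) _ e(2)]] escape_Base[of "tail G e"]] e by simp
      qed
    qed
    fix z assume z: "z \<in> ?W"
    then consider v where "v \<in> verts G" "z = Base v" | e where "e \<in> arcs G" "z = Pt e"
      | e where "e \<in> arcs G" "z = Qt e" by auto
    then show "?R z"
      using escape_Base escape_Pt escape_Qt z by cases simp_all
  qed (use x y in auto)
qed

end

theorem mainTheorem4:
  fixes G :: "('v, 'd) pre_digraph" and arev rot :: "'d \<Rightarrow> 'd"
  assumes "embedded_graph G arev rot"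
    and "loopfree_digraph G" and "nomulti_digraph G"
    and "three_connected G"
  shows "three_connected (Ambo G arev rot) \<and>
    three_connected (Truncation G arev rot) \<and>
    three_connected (Capra G arev rot) \<and>
    three_connected (Chamfer G arev rot) \<and>
    three_connected (Snub G arev rot) \<and>
    three_connected (Gyro G arev rot) \<and>
    three_connected (Leapfrog G arev rot)"
proof -
  interpret simple_three_connected_embedding G arev rot
    using assms by (intro simple_three_connected_embedding.intro simple_three_connected_embedding_axioms.intro)
  show ?thesis
    using three_connected_Ambo three_connected_Truncation three_connected_Capra three_connected_Chamfer
      three_connected_Snub three_connected_Gyro three_connected_Leapfrog by simp
qed

end
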